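(* Let $p$ be a closed polygon in $\mathbb R^n$ with vertices $p(\theta_1),\dots,p(\theta_m)$. The summands in the definition of $E^m_{\cos}(p)$ are all nonnegative, and $E^m_{\cos}(p)$ is zero if and only if the angle between all the circles $C_{i,j}$ and $C_{j,i}$ is zero, and hence if all the vertices of the polygon $p$ lie on one circle.
   Context: For a closed polygon $p$ with vertices $p(\theta_1),\dots,p(\theta_m)\in\mathbb R^n$ (indices modulo $m$) write $\Delta_i^jp=p(\theta_j)-p(\theta_i)$, $\Delta_ip=\Delta_i^{i+1}p$, and $d_m(i,j)=\min\{|i-j|,m-|i-j|\}$ for $i,j\in\{1,\dots,m\}$. The four points $p(\theta_i),p(\theta_{i+1}),p(\theta_j),p(\theta_{j+1})$ are assumed pairwise different when $d_m(i,j)>1$. Let $C_{i,j}$ be the circle through $p(\theta_i),p(\theta_{i+1}),p(\theta_j)$, oriented so that these points are passed in this cyclic order. Let $\alpha_{ij}$ be the angle at which $C_{i,j}$ and $C_{j,i}$ meet (measured at the common point $p(\theta_j)$), and $\tilde\alpha_{ij}$ the angle at which $C_{i,(j+1)}$ and $C_{j,(i+1)}$ meet (measured at the common point $p(\theta_{i+1})$); the cosine is the inner product of the two oriented unit tangent vectors at the common point. The unit tangent at $c$ of the oriented circle through pairwise distinct points $a,b,c$ (in this cyclic order) is $$\frac{\|c-b\|^2(a-c)+\|a-c\|^2(c-b)}{\|a-c\|\,\|b-a\|\,\|c-b\|}.$$ Then, summing over pairs $(i,j)\in\{1,\dots,m\}^2$, $$E^m_{\cos}(p)=\sum_{d_m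(i,j)>1}\frac{\|\Delta_ip\|\,\|\Delta_jp\|}{\|\Delta_i^jp\|\,\|\Delta_{i+1}^{j+1}p\|}\Big(1-\tfrac12\big(\cos\alpha_{ij}+\cos\tilde\alpha_{ij}\big)\Big).$$
   Formalization: "All the vertices lie on one circle" is taken to mean that they lie on it in their cyclic order (in either sense), since for a square's vertices visited crosswise the oriented circles meet at angle π and the energy is positive. *)

theory Defs
  imports "HOL-Analysis.Analysis"
begin

text \<open>
  A closed polygon with \<open>m\<close> vertices is given by its vertex sequence, extended periodically to
  \<open>int\<close> so that indices are read modulo \<open>m\<close>; \<open>p i\<close> stands for \<open>p(\<theta>\<^sub>i)\<close>.
\<close>

definition closed_polygon :: "nat \<Rightarrow> (int \<Rightarrow> real ^ 'n) \<Rightarrow> bool" where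
  "closed_polygon m p \<longleftrightarrow> m \<ge> 1 \<and> (\<forall>k. p (k + int m) = p k)"

definition cyc_dist :: "nat \<Rightarrow> int \<Rightarrow> int \<Rightarrow> int" where
  "cyc_dist m i j = min \<bar>i - j\<bar> (int m - \<bar>i - j\<bar>)"

definition far_pairs :: "nat \<Rightarrow> (int \<times> int) set" where
  "far_pairs m = {(i, j). i \<in> {1..int m} \<and> j \<in> {1..int m} \<and> cyc_dist m i j > 1}"

definition nondegenerate :: "nat \<Rightarrow> (int \<Rightarrow> real ^ 'n) \<Rightarrow> bool" where
  "nondegenerate m p \<longleftrightarrow> (\<forall>(i, j) \<in> far_pairs m. distinct [p i, p (i + 1), p j, p (j + 1)])"

definition Delta :: "(int \<Rightarrow> real ^ 'n) \<Rightarrow> int \<Rightarrow> int \<Rightarrow> real ^ 'n" where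
  "Delta p i j = p j - p i"

text \<open>
  The oriented circle through pairwise distinct \<open>a\<close>, \<open>b\<close>, \<open>c\<close>, passed in this cyclic order, is
  represented by the triple \<open>(a, b, c)\<close>. For collinear points it is the line through them, and
  the tangent formula remains valid.
\<close>

type_synonym 'n oriented_circle = "(real ^ 'n) \<times> (real ^ 'n) \<times> (real ^ 'n)"

definition tangent_at_last :: "real ^ 'n \<Rightarrow> real ^ 'n \<Rightarrow> real ^ 'n \<Rightarrow> real ^ 'n" where
  "tangent_at_last a b c =
     ((norm (c - b))\<^sup>2 *\<^sub>R (a - c) + (norm (a - c))\<^sup>2 *\<^sub>R (c - b))
       /\<^sub>R (norm (a - c) * norm (b - a) * norm (c - b))"

text \<open>
  Circles are only evaluated at one of their three defining points, which is rotated into the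
  last position; the value 0 elsewhere is a dummy.
\<close>

definition unit_tangent :: "'n oriented_circle \<Rightarrow> real ^ 'n \<Rightarrow> real ^ 'n" where
  "unit_tangent C x = (case C of (a, b, c) \<Rightarrow>
     if x = c then tangent_at_last a b c
     else if x = a then tangent_at_last b c a
     else if x = b then tangent_at_last c a b
     else 0)"

definition circle_angle :: "'n oriented_circle \<Rightarrow> 'n oriented_circle \<Rightarrow> real ^ 'n \<Rightarrow> real" where
  "circle_angle C D x = arccos (unit_tangent C x \<bullet> unit_tangent D x)"

definition polygon_circle :: "(int \<Rightarrow> real ^ 'n) \<Rightarrow> int \<Rightarrow> int \<Rightarrow> 'n oriented_circle" where
  "polygon_circle p i j = (p i, p (i + 1), p j)"

definition alpha :: "(int \<Rightarrow> real ^ 'n) \<Rightarrow> int \<Rightarrow> int \<Rightarrow> real" where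
  "alpha p i j = circle_angle (polygon_circle p i j) (polygon_circle p j i) (p j)"

definition alpha_tilde :: "(int \<Rightarrow> real ^ 'n) \<Rightarrow> int \<Rightarrow> int \<Rightarrow> real" where
  "alpha_tilde p i j =
     circle_angle (polygon_circle p i (j + 1)) (polygon_circle p j (i + 1)) (p (i + 1))"

definition E_cos_summand :: "(int \<Rightarrow> real ^ 'n) \<Rightarrow> int \<Rightarrow> int \<Rightarrow> real" where
  "E_cos_summand p i j =
     (norm (Delta p i (i + 1)) * norm (Delta p j (j + 1)))
       / (norm (Delta p i j) * norm (Delta p (i + 1) (j + 1)))
       * (1 - 1 / 2 * (cos (alpha p i j) + cos (alpha_tilde p i j)))"

definition E_cos :: "nat \<Rightarrow> (int \<Rightarrow> real ^ 'n) \<Rightarrow> real" where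
  "E_cos m p = (\<Sum>(i, j) \<in> far_pairs m. E_cos_summand p i j)"

text \<open>
  The vertices lie on one circle (centre \<open>z\<close>, radius \<open>r\<close>, in the plane spanned by the
  orthonormal pair \<open>u\<close>, \<open>v\<close>) and the polygon goes round it once, i.e. the vertices occur on it in
  their cyclic order. The order matters because the circles are oriented: the vertices of a
  square visited crosswise give two opposite orientations of one circle, hence angle \<open>\<pi>\<close>.
  Either sense of rotation is covered, as \<open>v\<close> may be replaced by \<open>- v\<close>.
\<close>

definition vertices_on_one_circle :: "nat \<Rightarrow> (int \<Rightarrow> real ^ 'n) \<Rightarrow> bool" where
  "vertices_on_one_circle m p \<longleftrightarrow>
     (\<exists>z u v r t. r > 0 \<and> norm u = 1 \<and> norm v = 1 \<and> u \<bullet> v = 0 \<and>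
        (\<forall>k \<in> {1..int m}. p k = z + r *\<^sub>R (cos (t k) *\<^sub>R u + sin (t k) *\<^sub>R v)) \<and>
        strict_mono_on {1..int m} t \<and> t (int m) < t 1 + 2 * pi)"

end

theory Submission
  imports Defs
begin

text \<open>
  Write \<open>a, b, c, d\<close> for the four vertices \<open>p i, p (i + 1), p j, p (j + 1)\<close>. An inversion centred at
  \<open>c\<close> turns circles through \<open>c\<close> into lines: the tangent at \<open>c\<close> of the circle through \<open>a, b, c\<close> is
  the unit vector pointing from the image of \<open>b\<close> to the image of \<open>a\<close>. Hence \<open>alpha p i j\<close> is the
  exterior angle at the image of \<open>a\<close> of the triangle formed by the images of \<open>b, a, d\<close>. By the law
  of cosines its cosine depends only on the side lengths of that triangle, and these are given by
  the distances of the four points; the outcome is \<open>ptolemy_cos a b c d\<close>. The same computation with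
  an inversion centred at \<open>b\<close> gives the same value for \<open>alpha_tilde p i j\<close>, so both angles agree.

  Therefore each summand of the energy is a positive weight times \<open>1 - cos (alpha p i j)\<close>. This
  yields nonnegativity, and shows that the energy vanishes exactly if all angles \<open>alpha p i j\<close> do.
  The expression \<open>ptolemy_cos a b c d\<close> is \<open>1\<close> exactly in the case of equality in Ptolemy's
  inequality. For points in cyclic order on one circle, chords are sines of half the angle
  differences, and that equality is an identity between products of sines.
\<close>

section \<open>Tangents of circles and inversions\<close>

definition inversion :: "'a::real_inner \<Rightarrow> 'a \<Rightarrow> 'a" where
  "inversion w x = (x - w) /\<^sub>R (norm (x - w))\<^sup>2"

lemma norm_inversion_diff:
  fixes x y w :: "'a::real_inner"
  assumes "x \<noteq> w" "y \<noteq> w"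
  shows "norm (inversion w x - inversion w y) = norm (x - y) / (norm (x - w) * norm (y - w))"
proof -
  have main: "norm (u /\<^sub>R (norm u)\<^sup>2 - v /\<^sub>R (norm v)\<^sup>2) = norm (u - v) / (norm u * norm v)"
    if "u \<noteq> 0" "v \<noteq> 0" for u v :: 'a
  proof (rule power2_eq_imp_eq)
    have "(norm (u /\<^sub>R (norm u)\<^sup>2 - v /\<^sub>R (norm v)\<^sup>2))\<^sup>2
        = (norm u)\<^sup>2 / ((norm u)\<^sup>2)\<^sup>2 + (norm v)\<^sup>2 / ((norm v)\<^sup>2)\<^sup>2
          - 2 * (u \<bullet> v) / ((norm u)\<^sup>2 * (norm v)\<^sup>2)"
      by (simp add: power2_norm_eq_inner inner_diff inner_commute divide_simps)
         (simp add: power2_eq_square algebra_simps)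
    also have "\<dots> = ((norm u)\<^sup>2 + (norm v)\<^sup>2 - 2 * (u \<bullet> v)) / ((norm u)\<^sup>2 * (norm v)\<^sup>2)"
      using that by (simp add: field_simps power2_eq_square)
    also have "\<dots> = (norm (u - v) / (norm u * norm v))\<^sup>2"
      by (simp add: power_divide power_mult_distrib power2_norm_eq_inner inner_diff inner_commute)
    finally show "(norm (u /\<^sub>R (norm u)\<^sup>2 - v /\<^sub>R (norm v)\<^sup>2))\<^sup>2
        = (norm (u - v) / (norm u * norm v))\<^sup>2" .
  qed auto
  show ?thesis
    using main[of "x - w" "y - w"] assms by (simp add: inversion_def)
qed

text \<open>
  The given tangent vector is a rescaled difference of inverted points: the inversion maps the
  circle to the line through these points, and its direction is that of the tangent at the centre.
\<close>

lemma tangent_at_last_inversion: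
  fixes x y w :: "real ^ 'n"
  assumes "x \<noteq> w" "y \<noteq> w"
  shows "tangent_at_last x y w =
    (norm (x - w) * norm (y - w) / norm (x - y)) *\<^sub>R (inversion w x - inversion w y)"
proof -
  have main: "((norm v)\<^sup>2 *\<^sub>R u - (norm u)\<^sup>2 *\<^sub>R v) /\<^sub>R (norm u * k * norm v)
      = (norm u * norm v / k) *\<^sub>R (u /\<^sub>R (norm u)\<^sup>2 - v /\<^sub>R (norm v)\<^sup>2)"
    if "u \<noteq> 0" "v \<noteq> 0" for u v :: "real ^ 'n" and k :: real
    using that by (simp add: scaleR_diff_right field_simps power2_eq_square)
  have swap: "c *\<^sub>R (w - y) = - (c *\<^sub>R (y - w))" for c :: real
    by (simp add: algebra_simps)
  show ?thesis
    using main[of "x - w" "y - w" "norm (x - y)"] assms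
    by (simp add: tangent_at_last_def inversion_def norm_minus_commute[of w y]
        norm_minus_commute[of y x] swap)
qed

lemma norm_tangent_at_last:
  fixes x y w :: "real ^ 'n"
  assumes "x \<noteq> w" "y \<noteq> w" "x \<noteq> y"
  shows "norm (tangent_at_last x y w) = 1"
  using assms by (simp add: tangent_at_last_inversion norm_inversion_diff)

section \<open>The cosine as an expression in the mutual distances\<close>

text \<open>
  Multiplying the sides of the triangle of the inverted points \<open>b, a, d\<close> by a common factor turns
  them into the three products of opposite distances occurring in Ptolemy's theorem; this is the
  cosine of its exterior angle at the vertex opposite to the side
  \<open>norm (a - c) * norm (b - d)\<close>.
\<close>

definition ptolemy_cos :: "'a::real_inner \<Rightarrow> 'a \<Rightarrow> 'a \<Rightarrow> 'a \<Rightarrow> real" where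
  "ptolemy_cos a b c d =
     ((norm (a - c) * norm (b - d))\<^sup>2 - (norm (a - b) * norm (c - d))\<^sup>2
        - (norm (b - c) * norm (a - d))\<^sup>2)
     / (2 * (norm (a - b) * norm (c - d)) * (norm (b - c) * norm (a - d)))"

text \<open>
  This is the law of cosines for the triangle of the inverted points \<open>b, a, d\<close>, whose sides are
  obtained from the original distances by the distortion formula for inversions.
\<close>

lemma inner_tangents:
  fixes a b c d :: "real ^ 'n"
  assumes "distinct [a, b, c, d]"
  shows "tangent_at_last a b c \<bullet> tangent_at_last d a c = ptolemy_cos a b c d"
proof -
  have cosines: "(X - Y) \<bullet> (Z - X) = ((norm (Z - Y))\<^sup>2 - (norm (X - Y))\<^sup>2 - (norm (Z - X))\<^sup>2) / 2"
    for X Y Z :: "real ^ 'n"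
    by (simp add: power2_norm_eq_inner inner_diff inner_commute)
  have alg: "(x * y / p) * ((z * x / q) * (((r / (z * y))\<^sup>2 - (p / (x * y))\<^sup>2 - (q / (z * x))\<^sup>2) / 2))
     = ((x * r)\<^sup>2 - (p * z)\<^sup>2 - (y * q)\<^sup>2) / (2 * (p * z) * (y * q))"
    if "x \<noteq> 0" "y \<noteq> 0" "z \<noteq> 0" "p \<noteq> 0" "q \<noteq> 0" for x y z p q r :: real
    using that by (simp add: divide_simps power2_eq_square)
  have ne: "a \<noteq> c" "b \<noteq> c" "d \<noteq> c" "a \<noteq> b" "d \<noteq> a"
    using assms by auto
  have "tangent_at_last a b c \<bullet> tangent_at_last d a c
    = (norm (a - c) * norm (b - c) / norm (a - b)) * ((norm (d - c) * norm (a - c) / norm (d - a))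
      * (((norm (d - b) / (norm (d - c) * norm (b - c)))\<^sup>2
          - (norm (a - b) / (norm (a - c) * norm (b - c)))\<^sup>2
          - (norm (d - a) / (norm (d - c) * norm (a - c)))\<^sup>2) / 2))"
    using ne by (simp only: tangent_at_last_inversion inner_scaleR_left inner_scaleR_right cosines
        norm_inversion_diff not_False_eq_True) (rule mult.left_commute)
  also have "\<dots> = ((norm (a - c) * norm (d - b))\<^sup>2 - (norm (a - b) * norm (d - c))\<^sup>2
        - (norm (b - c) * norm (d - a))\<^sup>2)
     / (2 * (norm (a - b) * norm (d - c)) * (norm (b - c) * norm (d - a)))"
    by (rule alg) (use ne in auto)
  finally show ?thesis
    by (simp add: ptolemy_cos_def norm_minus_commute[of d])
qed

lemma abs_ptolemy_cos_le_1:
  fixes a b c d :: "real ^ 'n"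
  assumes "distinct [a, b, c, d]"
  shows "\<bar>ptolemy_cos a b c d\<bar> \<le> 1"
proof -
  have "norm (tangent_at_last a b c) = 1" "norm (tangent_at_last d a c) = 1"
    using assms by (auto intro!: norm_tangent_at_last)
  then show ?thesis
    using Cauchy_Schwarz_ineq2[of "tangent_at_last a b c" "tangent_at_last d a c"]
    by (simp add: inner_tangents[OF assms])
qed

lemma ptolemy_cos_eq_1_if_ptolemy_equality:
  fixes a b c d :: "'a::real_inner"
  assumes "distinct [a, b, c, d]"
    and eq: "norm (a - c) * norm (b - d) = norm (a - b) * norm (c - d) + norm (b - c) * norm (a - d)"
  shows "ptolemy_cos a b c d = 1"
proof -
  have alg: "((P + Q)\<^sup>2 - P\<^sup>2 - Q\<^sup>2) / (2 * P * Q) = 1" if "P \<noteq> 0" "Q \<noteq> 0" for P Q :: real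
    using that by (simp add: power2_sum)
  show ?thesis
    unfolding ptolemy_cos_def eq by (rule alg) (use assms in auto)
qed

lemma alpha_eq_arccos_ptolemy:
  assumes "distinct [p i, p (i + 1), p j, p (j + 1)]"
  shows "alpha p i j = arccos (ptolemy_cos (p i) (p (i + 1)) (p j) (p (j + 1)))"
  using assms inner_tangents[OF assms]
  by (auto simp: alpha_def circle_angle_def polygon_circle_def unit_tangent_def)

text \<open>
  The second angle arises from the first by rotating the four points to \<open>d, a, b, c\<close>, which
  permutes the factors of \<open>ptolemy_cos\<close> only.
\<close>

lemma alpha_tilde_eq_alpha:
  assumes "distinct [p i, p (i + 1), p j, p (j + 1)]"
  shows "alpha_tilde p i j = alpha p i j"
proof -
  have "distinct [p (j + 1), p i, p (i + 1), p j]"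
    using assms by auto
  from inner_tangents[OF this]
  have "alpha_tilde p i j = arccos (ptolemy_cos (p (j + 1)) (p i) (p (i + 1)) (p j))"
    using assms
    by (auto simp: alpha_tilde_def circle_angle_def polygon_circle_def unit_tangent_def)
  also have "ptolemy_cos (p (j + 1)) (p i) (p (i + 1)) (p j)
      = ptolemy_cos (p i) (p (i + 1)) (p j) (p (j + 1))"
    by (simp add: ptolemy_cos_def norm_minus_commute[of "p (j + 1)"] mult_ac diff_right_commute)
  finally show ?thesis
    using assms by (simp add: alpha_eq_arccos_ptolemy)
qed

section \<open>Polygons inscribed in a circle\<close>

lemma norm_circle_chord:
  fixes u v z :: "'a::real_inner"
  assumes "r > 0" "norm u = 1" "norm v = 1" "u \<bullet> v = 0" "x \<le> y" "y \<le> x + 2 * pi"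
  shows "norm ((z + r *\<^sub>R (cos x *\<^sub>R u + sin x *\<^sub>R v)) - (z + r *\<^sub>R (cos y *\<^sub>R u + sin y *\<^sub>R v)))
    = 2 * r * sin ((y - x) / 2)"
proof -
  let ?h = "sin ((y - x) / 2)"
  have two: "2 * ((y - x) / 2) = y - x"
    by simp
  have h: "?h \<ge> 0"
    using assms by (intro sin_ge_zero) auto
  have uu: "u \<bullet> u = 1" "v \<bullet> v = 1" "v \<bullet> u = 0"
    using assms by (auto simp: norm_eq_1 inner_commute)
  have split: "(z + r *\<^sub>R (cos x *\<^sub>R u + sin x *\<^sub>R v)) - (z + r *\<^sub>R (cos y *\<^sub>R u + sin y *\<^sub>R v))
    = r *\<^sub>R ((cos x - cos y) *\<^sub>R u + (sin x - sin y) *\<^sub>R v)"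
    by (simp add: algebra_simps)
  have "(norm ((cos x - cos y) *\<^sub>R u + (sin x - sin y) *\<^sub>R v))\<^sup>2 = (cos x - cos y)\<^sup>2 + (sin x - sin y)\<^sup>2"
    unfolding power2_norm_eq_inner
    by (simp only: inner_add_left inner_add_right inner_scaleR_left inner_scaleR_right uu assms(4))
       (simp add: power2_eq_square)
  also have "\<dots> = (cos x)\<^sup>2 + (sin x)\<^sup>2 + ((cos y)\<^sup>2 + (sin y)\<^sup>2) - 2 * (cos y * cos x + sin y * sin x)"
    by (simp add: power2_eq_square algebra_simps)
  also have "\<dots> = 2 - 2 * cos (y - x)"
    by (simp add: cos_diff)
  also have "\<dots> = (2 * ?h)\<^sup>2"
    using cos_double_sin[of "(y - x) / 2"] unfolding two by (simp only: power_mult_distrib) simp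
  finally have "norm ((cos x - cos y) *\<^sub>R u + (sin x - sin y) *\<^sub>R v) = 2 * ?h"
    using h by (auto intro: power2_eq_imp_eq)
  then show ?thesis
    unfolding split using \<open>r > 0\<close> by simp
qed

text \<open>
  With \<open>x, y, z\<close> the halved angular gaps between consecutive points on a circle, this is Ptolemy's
  theorem for chords measured by sines.
\<close>

lemma sin_ptolemy:
  fixes x y z :: real
  shows "sin (x + y) * sin (y + z) = sin x * sin z + sin y * sin (x + y + z)"
proof -
  have *: "(sx * cy + cx * sy) * (sy * cz + cy * sz)
    = sx * sz * (sy\<^sup>2 + cy\<^sup>2) + sy * ((sx * cy + cx * sy) * cz + (cx * cy - sx * sy) * sz)"
    for sx cx sy cy sz cz :: real
    by (simp add: power2_eq_square algebra_simps)
  show ?thesis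
    unfolding sin_add[of x y] sin_add[of y z] sin_add[of "x + y" z] cos_add[of x y]
    using *[of "sin x" "cos y" "cos x" "sin y" "cos z" "sin z"]
    by (simp only: sin_cos_squared_add mult_1_right)
qed

lemma ptolemy_circle:
  fixes u v z :: "'a::real_inner"
  assumes "r > 0" "norm u = 1" "norm v = 1" "u \<bullet> v = 0"
    and "w \<le> x" "x \<le> y" "y \<le> s" "s \<le> w + 2 * pi"
    and f: "\<And>x. f x = z + r *\<^sub>R (cos x *\<^sub>R u + sin x *\<^sub>R v)"
  shows "norm (f w - f y) * norm (f x - f s)
    = norm (f w - f x) * norm (f y - f s) + norm (f x - f y) * norm (f w - f s)"
proof -
  have chord: "norm (f h - f k) = 2 * r * sin ((k - h) / 2)" if "h \<le> k" "k \<le> h + 2 * pi" for h k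
    unfolding f using norm_circle_chord[OF assms(1-4) that] .
  have gaps: "(x - w) / 2 + (y - x) / 2 = (y - w) / 2" "(y - x) / 2 + (s - y) / 2 = (s - x) / 2"
    "(y - w) / 2 + (s - y) / 2 = (s - w) / 2"
    by (simp_all add: field_simps)
  have sines: "sin ((y - w) / 2) * sin ((s - x) / 2) = sin ((x - w) / 2) * sin ((s - y) / 2)
      + sin ((y - x) / 2) * sin ((s - w) / 2)"
    using sin_ptolemy[of "(x - w) / 2" "(y - x) / 2" "(s - y) / 2"] unfolding gaps .
  have scale: "(2 * r * A) * (2 * r * B) = (2 * r * C) * (2 * r * D) + (2 * r * E) * (2 * r * F)"
    if "A * B = C * D + E * F" for A B C D E F
  proof -
    have "(2 * r * A) * (2 * r * B) = (2 * r) * (2 * r) * (A * B)"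
      by (simp only: mult_ac)
    also have "\<dots> = (2 * r * C) * (2 * r * D) + (2 * r * E) * (2 * r * F)"
      unfolding that by (simp only: distrib_left mult_ac)
    finally show ?thesis .
  qed
  have "norm (f w - f y) = 2 * r * sin ((y - w) / 2)" "norm (f x - f s) = 2 * r * sin ((s - x) / 2)"
    "norm (f w - f x) = 2 * r * sin ((x - w) / 2)" "norm (f y - f s) = 2 * r * sin ((s - y) / 2)"
    "norm (f x - f y) = 2 * r * sin ((y - x) / 2)" "norm (f w - f s) = 2 * r * sin ((s - w) / 2)"
    using assms(5-8) by - (rule chord; linarith)+
  then show ?thesis
    using scale[OF sines] by (simp only:)
qed

lemma vertices_on_one_circle_alpha_eq_0:
  fixes p :: "int \<Rightarrow> real ^ 'n"
  assumes closed: "closed_polygon m p" and nondeg: "nondegenerate m p"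
    and circ: "vertices_on_one_circle m p" and far: "(i, j) \<in> far_pairs m"
  shows "alpha p i j = 0"
proof -
  obtain z u v r t where r: "r > 0" "norm u = 1" "norm v = 1" "u \<bullet> v = 0"
    and p: "\<And>k. k \<in> {1..int m} \<Longrightarrow> p k = z + r *\<^sub>R (cos (t k) *\<^sub>R u + sin (t k) *\<^sub>R v)"
    and mono: "strict_mono_on {1..int m} t" and wrap: "t (int m) < t 1 + 2 * pi"
    using circ unfolding vertices_on_one_circle_def by blast
  define f where "f x = z + r *\<^sub>R (cos x *\<^sub>R u + sin x *\<^sub>R v)" for x
  \<comment> \<open>The vertex after the last one is the first one again, one full turn later.\<close>
  define T where "T k = (if k = int m + 1 then t 1 + 2 * pi else t k)" for k
  have pf: "p k = f (T k)" if "k \<in> {1..int m + 1}" for k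
  proof (cases "k = int m + 1")
    case True
    have "1 \<le> m" and "p (1 + int m) = p 1"
      using closed by (auto simp: closed_polygon_def)
    with True p[of 1] show ?thesis
      by (simp add: f_def T_def add.commute)
  next
    case False
    with that p[of k] show ?thesis
      by (simp add: f_def T_def)
  qed
  have t_le: "t k \<le> t l" if "1 \<le> k" "k \<le> l" "l \<le> int m" for k l
    using strict_mono_onD[OF mono, of k l] that by (cases "k = l") auto
  have T_le: "T k \<le> T l" if "1 \<le> k" "k \<le> l" "l \<le> int m + 1" for k l
    using that t_le[of k l] t_le[of k "int m"] wrap by (auto simp: T_def)
  have turn: "T l \<le> T k + 2 * pi" if "1 \<le> k" "k \<le> int m" "l \<le> int m + 1" "k \<le> l" for k l
    using that T_le[of l "int m + 1"] T_le[of 1 k] by (auto simp: T_def)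
  have ptolemy: "norm (p k - p l) * norm (p (k + 1) - p (l + 1))
      = norm (p k - p (k + 1)) * norm (p l - p (l + 1)) + norm (p (k + 1) - p l) * norm (p k - p (l + 1))"
    if "1 \<le> k" "k < l" "l \<le> int m" for k l
    using that ptolemy_circle[OF r, of "T k" "T (k + 1)" "T l" "T (l + 1)" f z]
      T_le[of k "k + 1"] T_le[of "k + 1" l] T_le[of l "l + 1"] turn[of k "l + 1"]
    by (simp add: pf f_def)
  have dist: "distinct [p i, p (i + 1), p j, p (j + 1)]"
    using nondeg far by (auto simp: nondegenerate_def)
  have range: "1 \<le> i" "i \<le> int m" "1 \<le> j" "j \<le> int m" "i \<noteq> j"
    using far by (auto simp: far_pairs_def cyc_dist_def)
  have "norm (p i - p j) * norm (p (i + 1) - p (j + 1))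
      = norm (p i - p (i + 1)) * norm (p j - p (j + 1)) + norm (p (i + 1) - p j) * norm (p i - p (j + 1))"
  proof (cases "i < j")
    case True
    with range show ?thesis by (intro ptolemy)
  next
    case False
    with range ptolemy[of j i] show ?thesis
      by (simp add: norm_minus_commute[of "p j" "p i"] norm_minus_commute[of "p (j + 1)" "p (i + 1)"]
          norm_minus_commute[of "p (j + 1)" "p i"] norm_minus_commute[of "p j" "p (i + 1)"] mult.commute)
  qed
  then show ?thesis
    using dist by (simp add: alpha_eq_arccos_ptolemy ptolemy_cos_eq_1_if_ptolemy_equality)
qed

section \<open>The energy\<close>

lemma finite_far_pairs: "finite (far_pairs m)"
  by (rule finite_subset[of _ "{1..int m} \<times> {1..int m}"]) (auto simp: far_pairs_def)

lemma E_cos_summand_eq: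
  assumes "distinct [p i, p (i + 1), p j, p (j + 1)]"
  shows "E_cos_summand p i j =
    (norm (Delta p i (i + 1)) * norm (Delta p j (j + 1)))
       / (norm (Delta p i j) * norm (Delta p (i + 1) (j + 1))) * (1 - cos (alpha p i j))"
  by (simp add: E_cos_summand_def alpha_tilde_eq_alpha[OF assms])

lemma E_cos_summand_nonneg:
  assumes "distinct [p i, p (i + 1), p j, p (j + 1)]"
  shows "E_cos_summand p i j \<ge> 0"
  by (simp add: E_cos_summand_eq[OF assms])

lemma E_cos_summand_eq_0_iff:
  assumes "distinct [p i, p (i + 1), p j, p (j + 1)]"
  shows "E_cos_summand p i j = 0 \<longleftrightarrow> alpha p i j = 0"
proof -
  let ?x = "ptolemy_cos (p i) (p (i + 1)) (p j) (p (j + 1))"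
  have "\<bar>?x\<bar> \<le> 1"
    by (rule abs_ptolemy_cos_le_1[OF assms])
  then have "cos (alpha p i j) = ?x"
    by (simp add: alpha_eq_arccos_ptolemy[OF assms] cos_arccos_abs)
  then have "cos (alpha p i j) = 1 \<longleftrightarrow> alpha p i j = 0"
    using alpha_eq_arccos_ptolemy[OF assms] by auto
  then show ?thesis
    using assms by (auto simp: E_cos_summand_eq Delta_def)
qed

theorem mainTheorem3:
  fixes p :: "int \<Rightarrow> real ^ 'n" and m :: nat
  assumes "closed_polygon m p"
    and "nondegenerate m p"
  shows "(\<forall>(i, j) \<in> far_pairs m. E_cos_summand p i j \<ge> 0)
    \<and> (E_cos m p = 0 \<longleftrightarrow> (\<forall>(i, j) \<in> far_pairs m. alpha p i j = 0))
    \<and> (vertices_on_one_circle m p \<longrightarrow> E_cos m p = 0)"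
proof -
  have dist: "distinct [p i, p (i + 1), p j, p (j + 1)]" if "(i, j) \<in> far_pairs m" for i j
    using assms(2) that by (auto simp: nondegenerate_def)
  have nonneg: "\<forall>(i, j) \<in> far_pairs m. E_cos_summand p i j \<ge> 0"
    using dist E_cos_summand_nonneg by blast
  have "E_cos m p = 0 \<longleftrightarrow> (\<forall>(i, j) \<in> far_pairs m. E_cos_summand p i j = 0)"
    unfolding E_cos_def using nonneg
    by (subst sum_nonneg_eq_0_iff[OF finite_far_pairs]) auto
  also have "\<dots> \<longleftrightarrow> (\<forall>(i, j) \<in> far_pairs m. alpha p i j = 0)"
    using dist E_cos_summand_eq_0_iff by blast
  finally have zero: "E_cos m p = 0 \<longleftrightarrow> (\<forall>(i, j) \<in> far_pairs m. alpha p i j = 0)" .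
  moreover have "\<forall>(i, j) \<in> far_pairs m. alpha p i j = 0" if "vertices_on_one_circle m p"
    using vertices_on_one_circle_alpha_eq_0[OF assms that] by blast
  ultimately show ?thesis
    using nonneg by blast
qed

end
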